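(* Let $\mathfrak g$ be a finite-dimensional nilpotent Lie algebra over $\mathbb R$ and let $\alpha,\beta\in\operatorname{der}(\mathfrak g)$ be diagonalizable derivations (over $\mathbb R$) with strictly positive eigenvalues. If $\alpha$ and $\beta$ define isomorphic Heintze groups, then they define equivalent $\mathbb R$-gradings of $\mathfrak g$.
   Context: The Heintze group defined by a derivation $\alpha\in\operatorname{der}(\mathfrak g)$ whose eigenvalues have strictly positive real parts is the simply connected Lie group whose Lie algebra is the semidirect product $\mathfrak g\rtimes_\alpha\mathbb R$ (where the generator $T$ of $\mathbb R$ acts by $[T,X]=\alpha(X)$ for $X\in\mathfrak g$). Isomorphic means isomorphic as Lie groups. A diagonalizable derivation $\alpha$ with real eigenvalues defines the $\mathbb R$-grading $\mathfrak g=\bigoplus_{\lambda\in\mathbb R}V_\lambda$ with $V_\lambda=\ker(\alpha-\lambda\,\mathrm{Id})$, which satisfies $[V_\lambda,V_\mu]\subset V_{\lambda+\mu}$. Two $\mathbb R$-gradings $\mathfrak g=\bigoplus_\lambda V_\lambda$ and $\mathfrak g=\bigoplus_\lambda W_\lambda$ are equivalent if there exist $\Phi\in\operatorname{Aut}(\mathfrak g)$ and a group isomorphism $f:\mathbb R\to\mathbb R$ (of the additive group) with $W_{f(\lambda)}=\Phi(V_\lambda)$ for all $\lambda\in\mathbb R$. *)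

theory Defs
  imports "HOL-Analysis.Analysis" "HOL-Algebra.Group"
begin

section \<open>Finite-dimensional real Lie algebras\<close>

text \<open>The underlying vector space of the Lie algebra is a whole type of class
  \<^class>\<open>real_vector\<close>, so that the zero Lie algebra is not excluded.\<close>

definition finite_dimensional :: "'a::real_vector itself \<Rightarrow> bool" where
  "finite_dimensional _ \<longleftrightarrow> (\<exists>B::'a set. finite B \<and> span B = UNIV)"

definition lie_bracket :: "('a::real_vector \<Rightarrow> 'a \<Rightarrow> 'a) \<Rightarrow> bool" where
  "lie_bracket br \<longleftrightarrow>
     bilinear br \<and>
     (\<forall>x. br x x = 0) \<and>
     (\<forall>x y z. br x (br y z) + br y (br z x) + br z (br x y) = 0)"

fun lower_central_series :: "('a::real_vector \<Rightarrow> 'a \<Rightarrow> 'a) \<Rightarrow> nat \<Rightarrow> 'a set" where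
  "lower_central_series br 0 = UNIV"
| "lower_central_series br (Suc n) = span {br x y | x y. y \<in> lower_central_series br n}"

definition nilpotent_bracket :: "('a::real_vector \<Rightarrow> 'a \<Rightarrow> 'a) \<Rightarrow> bool" where
  "nilpotent_bracket br \<longleftrightarrow> (\<exists>n. lower_central_series br n = {0})"

definition derivation :: "('a::real_vector \<Rightarrow> 'a \<Rightarrow> 'a) \<Rightarrow> ('a \<Rightarrow> 'a) \<Rightarrow> bool" where
  "derivation br \<alpha> \<longleftrightarrow>
     linear \<alpha> \<and> (\<forall>x y. \<alpha> (br x y) = br (\<alpha> x) y + br x (\<alpha> y))"

definition lie_automorphism :: "('a::real_vector \<Rightarrow> 'a \<Rightarrow> 'a) \<Rightarrow> ('a \<Rightarrow> 'a) \<Rightarrow> bool" where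
  "lie_automorphism br \<Phi> \<longleftrightarrow>
     linear \<Phi> \<and> bij \<Phi> \<and> (\<forall>x y. \<Phi> (br x y) = br (\<Phi> x) (\<Phi> y))"

definition eigenspace :: "('a::real_vector \<Rightarrow> 'a) \<Rightarrow> real \<Rightarrow> 'a set" where
  "eigenspace \<alpha> \<mu> = {x. \<alpha> x = \<mu> *\<^sub>R x}"

definition eigenvalue_of :: "('a::real_vector \<Rightarrow> 'a) \<Rightarrow> real \<Rightarrow> bool" where
  "eigenvalue_of \<alpha> \<mu> \<longleftrightarrow> (\<exists>x. x \<noteq> 0 \<and> \<alpha> x = \<mu> *\<^sub>R x)"

definition real_diagonalizable :: "('a::real_vector \<Rightarrow> 'a) \<Rightarrow> bool" where
  "real_diagonalizable \<alpha> \<longleftrightarrow>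
     (\<exists>B. independent B \<and> span B = UNIV \<and> (\<forall>b\<in>B. \<exists>\<mu>. \<alpha> b = \<mu> *\<^sub>R b))"

text \<open>Gradings are given by the family of their homogeneous components; the grading defined
  by a diagonalizable derivation \<open>\<alpha>\<close> is \<open>eigenspace \<alpha>\<close>.\<close>

definition equivalent_gradings ::
    "('a::real_vector \<Rightarrow> 'a \<Rightarrow> 'a) \<Rightarrow> (real \<Rightarrow> 'a set) \<Rightarrow> (real \<Rightarrow> 'a set) \<Rightarrow> bool" where
  "equivalent_gradings br V W \<longleftrightarrow>
     (\<exists>\<Phi> f. lie_automorphism br \<Phi> \<and>
            bij f \<and> (\<forall>s t. f (s + t) = f s + f t) \<and>
            (\<forall>\<mu>. W (f \<mu>) = \<Phi> ` V \<mu>))"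

text \<open>The pair \<open>(X, s)\<close> stands for \<open>X + s T\<close>, where \<open>[T, X] = \<alpha> X\<close>.\<close>

definition semidirect_bracket ::
    "('a::real_vector \<Rightarrow> 'a \<Rightarrow> 'a) \<Rightarrow> ('a \<Rightarrow> 'a) \<Rightarrow> 'a \<times> real \<Rightarrow> 'a \<times> real \<Rightarrow> 'a \<times> real" where
  "semidirect_bracket br \<alpha> = (\<lambda>(X, s) (Y, t). (br X Y + s *\<^sub>R \<alpha> Y - t *\<^sub>R \<alpha> X, 0))"

section \<open>Smooth manifolds\<close>

text \<open>For open \<open>S\<close> in a finite-dimensional space, \<open>C_k_on k S f\<close> says that \<open>f\<close> is of class
  \<open>C^k\<close> on \<open>S\<close>.\<close>

fun C_k_on :: "nat \<Rightarrow> 'e::euclidean_space set \<Rightarrow> ('e \<Rightarrow> 'f::euclidean_space) \<Rightarrow> bool" where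
  "C_k_on 0 S f \<longleftrightarrow> continuous_on S f"
| "C_k_on (Suc k) S f \<longleftrightarrow>
     (\<exists>f'. (\<forall>x\<in>S. (f has_derivative f' x) (at x)) \<and> (\<forall>v. C_k_on k S (\<lambda>x. f' x v)))"

definition smooth_on :: "'e::euclidean_space set \<Rightarrow> ('e \<Rightarrow> 'f::euclidean_space) \<Rightarrow> bool" where
  "smooth_on S f \<longleftrightarrow> (\<forall>k. C_k_on k S f)"

text \<open>A chart is a pair of its domain and the coordinate map. The manifold is the whole type,
  with its type class topology; an atlas need not be maximal.\<close>

type_synonym ('m, 'e) atlas = "('m set \<times> ('m \<Rightarrow> 'e)) set"

definition chart :: "'m::topological_space set \<times> ('m \<Rightarrow> 'e::euclidean_space) \<Rightarrow> bool" where
  "chart = (\<lambda>(U, \<phi>). open U \<and> open (\<phi> ` U) \<and> homeomorphism U (\<phi> ` U) \<phi> (inv_into U \<phi>))"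

definition smooth_atlas :: "('m::topological_space, 'e::euclidean_space) atlas \<Rightarrow> bool" where
  "smooth_atlas A \<longleftrightarrow>
     (\<forall>c\<in>A. chart c) \<and> \<Union> (fst ` A) = UNIV \<and>
     (\<forall>(U, \<phi>)\<in>A. \<forall>(V, \<psi>)\<in>A. smooth_on (\<phi> ` (U \<inter> V)) (\<psi> \<circ> inv_into U \<phi>))"

definition smooth_map ::
    "('m::topological_space, 'e::euclidean_space) atlas \<Rightarrow>
     ('n::topological_space, 'f::euclidean_space) atlas \<Rightarrow> ('m \<Rightarrow> 'n) \<Rightarrow> bool" where
  "smooth_map A B F \<longleftrightarrow>
     continuous_on UNIV F \<and>
     (\<forall>(U, \<phi>)\<in>A. \<forall>(V, \<psi>)\<in>B. smooth_on (\<phi> ` (U \<inter> F -` V)) (\<psi> \<circ> F \<circ> inv_into U \<phi>))"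

definition product_atlas ::
    "('m, 'e) atlas \<Rightarrow> ('n, 'f) atlas \<Rightarrow> ('m \<times> 'n, 'e \<times> 'f) atlas" where
  "product_atlas A B = {(U \<times> V, map_prod \<phi> \<psi>) | U \<phi> V \<psi>. (U, \<phi>) \<in> A \<and> (V, \<psi>) \<in> B}"

definition real_atlas :: "(real, real) atlas" where
  "real_atlas = {(UNIV, id)}"

abbreviation smooth_function ::
    "('m::topological_space, 'e::euclidean_space) atlas \<Rightarrow> ('m \<Rightarrow> real) \<Rightarrow> bool" where
  "smooth_function A f \<equiv> smooth_map A real_atlas f"

section \<open>Lie groups and their Lie algebras\<close>

definition lie_group ::
    "'g::{t2_space,second_countable_topology} monoid \<Rightarrow> ('g, 'e::euclidean_space) atlas \<Rightarrow> bool"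
  where
  "lie_group G A \<longleftrightarrow>
     group G \<and> carrier G = UNIV \<and> smooth_atlas A \<and>
     smooth_map (product_atlas A A) A (\<lambda>(x, y). x \<otimes>\<^bsub>G\<^esub> y) \<and>
     smooth_map A A (\<lambda>x. inv\<^bsub>G\<^esub> x)"

definition isomorphic_lie_groups ::
    "'g::{t2_space,second_countable_topology} monoid \<Rightarrow> ('g, 'e::euclidean_space) atlas \<Rightarrow>
     'h::{t2_space,second_countable_topology} monoid \<Rightarrow> ('h, 'f::euclidean_space) atlas \<Rightarrow> bool"
  where
  "isomorphic_lie_groups G A H B \<longleftrightarrow>
     (\<exists>F\<in>iso G H. smooth_map A B F \<and> smooth_map B A (inv_into (carrier G) F))"

text \<open>The Lie algebra of a Lie group consists of the left-invariant smooth vector fields, a smooth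
  vector field being a derivation of the algebra of smooth functions; the bracket is the
  commutator. The value of \<open>D\<close> on non-smooth functions is fixed to be zero, so that
  equality of vector fields is equality of HOL functions.\<close>

definition vector_field ::
    "('m::topological_space, 'e::euclidean_space) atlas \<Rightarrow> (('m \<Rightarrow> real) \<Rightarrow> ('m \<Rightarrow> real)) \<Rightarrow> bool"
  where
  "vector_field A D \<longleftrightarrow>
     (\<forall>f. \<not> smooth_function A f \<longrightarrow> D f = (\<lambda>p. 0)) \<and>
     (\<forall>f. smooth_function A f \<longrightarrow> smooth_function A (D f)) \<and>
     (\<forall>f h. smooth_function A f \<and> smooth_function A h \<longrightarrow>
        D (\<lambda>p. f p + h p) = (\<lambda>p. D f p + D h p)) \<and>
     (\<forall>c f. smooth_function A f \<longrightarrow> D (\<lambda>p. c * f p) = (\<lambda>p. c * D f p)) \<and>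
     (\<forall>f h. smooth_function A f \<and> smooth_function A h \<longrightarrow>
        D (\<lambda>p. f p * h p) = (\<lambda>p. D f p * h p + f p * D h p))"

definition left_invariant_fields ::
    "'g::{t2_space,second_countable_topology} monoid \<Rightarrow> ('g, 'e::euclidean_space) atlas \<Rightarrow>
     (('g \<Rightarrow> real) \<Rightarrow> ('g \<Rightarrow> real)) set"
  where
  "left_invariant_fields G A =
     {D. vector_field A D \<and>
         (\<forall>g f. smooth_function A f \<longrightarrow>
            D (\<lambda>p. f (g \<otimes>\<^bsub>G\<^esub> p)) = (\<lambda>p. D f (g \<otimes>\<^bsub>G\<^esub> p)))}"

definition commutator ::
    "(('m \<Rightarrow> real) \<Rightarrow> ('m \<Rightarrow> real)) \<Rightarrow> (('m \<Rightarrow> real) \<Rightarrow> ('m \<Rightarrow> real)) \<Rightarrow> (('m \<Rightarrow> real) \<Rightarrow> ('m \<Rightarrow> real))"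
  where
  "commutator D E = (\<lambda>f p. D (E f) p - E (D f) p)"

text \<open>\<open>br\<close> is a bracket on \<open>'l\<close>, and \<open>\<Theta>\<close> below is an isomorphism of Lie algebras from \<open>'l\<close>
  onto the Lie algebra of \<open>G\<close>.\<close>

definition has_lie_algebra ::
    "'g::{t2_space,second_countable_topology} monoid \<Rightarrow> ('g, 'e::euclidean_space) atlas \<Rightarrow>
     ('l::real_vector \<Rightarrow> 'l \<Rightarrow> 'l) \<Rightarrow> bool"
  where
  "has_lie_algebra G A br \<longleftrightarrow>
     (\<exists>\<Theta>. bij_betw \<Theta> UNIV (left_invariant_fields G A) \<and>
          (\<forall>x y. \<Theta> (x + y) = (\<lambda>f p. \<Theta> x f p + \<Theta> y f p)) \<and>
          (\<forall>c x. \<Theta> (c *\<^sub>R x) = (\<lambda>f p. c * \<Theta> x f p)) \<and>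
          (\<forall>x y. \<Theta> (br x y) = commutator (\<Theta> x) (\<Theta> y)))"

text \<open>\<open>(G, A)\<close> is a Heintze group of \<open>\<alpha>\<close>, the condition on the eigenvalues of \<open>\<alpha>\<close>
  being imposed separately. Such a group is unique up to isomorphism.\<close>

definition heintze_group ::
    "('a::real_vector \<Rightarrow> 'a \<Rightarrow> 'a) \<Rightarrow> ('a \<Rightarrow> 'a) \<Rightarrow>
     'g::{t2_space,second_countable_topology} monoid \<Rightarrow> ('g, 'e::euclidean_space) atlas \<Rightarrow> bool"
  where
  "heintze_group br \<alpha> G A \<longleftrightarrow>
     lie_group G A \<and> simply_connected (UNIV :: 'g set) \<and>
     has_lie_algebra G A (semidirect_bracket br \<alpha>)"

end

theory Submission
  imports Defs
begin

text \<open>An isomorphism of the Lie groups induces an isomorphism \<open>\<psi>\<close> between the semidirect products.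
  Since \<open>\<alpha>\<close> and \<open>\<beta>\<close> are invertible, the ideal \<open>X + 0 T\<close> is the derived algebra on both sides, so \<open>\<psi>\<close>
  restricts to an automorphism \<open>\<phi>\<close> and sends \<open>T\<close> to \<open>y + c T\<close> with \<open>c \<noteq> 0\<close>; hence
  \<open>\<phi> \<alpha> \<phi>\<^sup>-\<^sup>1 = ad y + c \<beta>\<close>. As \<open>\<beta>\<close> has positive weights, \<open>ad y\<close> strictly raises them, and an
  automorphism built from leading terms of eigenvectors conjugates \<open>c \<beta>\<close> to \<open>ad y + c \<beta>\<close>. Thus \<open>\<alpha>\<close> is
  conjugate to \<open>c \<beta>\<close>, and the gradings are equivalent through \<open>f \<mu> = \<mu> / c\<close>.\<close>

section \<open>Composition of smooth maps\<close>

lemma C_k_on_cong: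
  assumes "open S" "\<And>x. x \<in> S \<Longrightarrow> f x = g x" "C_k_on k S f"
  shows "C_k_on k S g"
proof (cases k)
  case 0
  then show ?thesis using assms by (auto cong: continuous_on_cong)
next
  case (Suc j)
  with assms(3) obtain f' where f': "\<forall>x\<in>S. (f has_derivative f' x) (at x)"
    "\<forall>v. C_k_on j S (\<lambda>x. f' x v)"
    by auto
  have "\<forall>x\<in>S. (g has_derivative f' x) (at x)"
    using f'(1) assms(1,2) has_derivative_transform_within_open by blast
  with f'(2) Suc show ?thesis by auto
qed

text \<open>Derivatives at interior points are unique, so the local derivatives patch together. This
  lets smoothness be checked on pieces small enough to be seen through a single chart of the
  target.\<close>

lemma C_k_on_local:
  assumes "\<And>x. x \<in> S \<Longrightarrow> \<exists>T. open T \<and> x \<in> T \<and> C_k_on k T f"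
  shows "C_k_on k S f"
  using assms
proof (induction k arbitrary: f)
  case 0
  have "continuous (at x within S) f" if x: "x \<in> S" for x
  proof -
    obtain T where "open T" "x \<in> T" "continuous_on T f" using 0[OF x] by auto
    then have "isCont f x" using continuous_on_eq_continuous_at by blast
    then show ?thesis by (rule continuous_at_imp_continuous_at_within)
  qed
  then show ?case by (simp add: continuous_on_eq_continuous_within)
next
  case (Suc k)
  \<comment> \<open>One global choice replaces the witnesses, which otherwise vary with the
    neighbourhood.\<close>
  define f' where "f' x = frechet_derivative f (at x)" for x
  have *: "\<exists>T. open T \<and> x \<in> T \<and> (\<forall>y\<in>T. (f has_derivative f' y) (at y)) \<and> (\<forall>v. C_k_on k T (\<lambda>y. f' y v))"
    if "x \<in> S" for x
  proof -
    obtain T g where T: "open T" "x \<in> T" "\<forall>y\<in>T. (f has_derivative g y) (at y)"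
      "\<forall>v. C_k_on k T (\<lambda>y. g y v)"
      using Suc.prems[OF \<open>x \<in> S\<close>] by auto
    then have eq: "g y = f' y" if "y \<in> T" for y
      using that frechet_derivative_at unfolding f'_def by blast
    have "C_k_on k T (\<lambda>y. f' y v)" for v
      by (rule C_k_on_cong[of T "\<lambda>y. g y v"]) (use T eq in auto)
    with T eq show ?thesis by auto
  qed
  have "C_k_on k S (\<lambda>x. f' x v)" for v
    by (rule Suc.IH) (use * in blast)
  moreover have "\<forall>x\<in>S. (f has_derivative f' x) (at x)" using * by blast
  ultimately show ?case by auto
qed

lemma C_k_on_Suc_D: "C_k_on (Suc k) S f \<Longrightarrow> C_k_on k S f"
proof (induction k arbitrary: f)
  case 0
  then show ?case
    by (auto intro!: continuous_at_imp_continuous_on dest: has_derivative_continuous)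
next
  case (Suc k)
  then obtain f' where f': "\<forall>x\<in>S. (f has_derivative f' x) (at x)"
    "\<forall>v. C_k_on (Suc k) S (\<lambda>x. f' x v)"
    using C_k_on.simps(2) by blast
  then show ?case using Suc.IH C_k_on.simps(2) by blast
qed

lemma C_k_on_const: "C_k_on k S (\<lambda>_. c)"
  by (induction k arbitrary: c) (auto intro!: exI[of _ "\<lambda>_ _. 0"])

lemma C_k_on_add: "C_k_on k S f \<Longrightarrow> C_k_on k S g \<Longrightarrow> C_k_on k S (\<lambda>x. f x + g x)"
proof (induction k arbitrary: f g)
  case 0
  then show ?case by (auto intro: continuous_on_add)
next
  case (Suc k)
  then obtain f' g' where "\<forall>x\<in>S. (f has_derivative f' x) (at x)" "\<forall>v. C_k_on k S (\<lambda>x. f' x v)"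
    "\<forall>x\<in>S. (g has_derivative g' x) (at x)" "\<forall>v. C_k_on k S (\<lambda>x. g' x v)"
    by auto
  then show ?case
    unfolding C_k_on.simps
    by (intro exI[of _ "\<lambda>x v. f' x v + g' x v"]) (auto intro: has_derivative_add Suc.IH)
qed

lemma C_k_on_sum:
  "finite I \<Longrightarrow> (\<And>i. i \<in> I \<Longrightarrow> C_k_on k S (f i)) \<Longrightarrow> C_k_on k S (\<lambda>x. \<Sum>i\<in>I. f i x)"
  by (induction I rule: finite_induct) (auto intro: C_k_on_const C_k_on_add)

lemma C_k_on_inner: "C_k_on k S f \<Longrightarrow> C_k_on k S (\<lambda>x. f x \<bullet> b)"
proof (induction k arbitrary: f)
  case 0
  then show ?case by (auto intro: continuous_intros)
next
  case (Suc k)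
  then obtain f' where "\<forall>x\<in>S. (f has_derivative f' x) (at x)" "\<forall>v. C_k_on k S (\<lambda>x. f' x v)"
    by auto
  then show ?case
    unfolding C_k_on.simps
    by (intro exI[of _ "\<lambda>x v. f' x v \<bullet> b"]) (auto intro: has_derivative_inner_left Suc.IH)
qed

lemma C_k_on_scaleR:
  fixes f :: "'e::euclidean_space \<Rightarrow> real"
  shows "C_k_on k S f \<Longrightarrow> C_k_on k S g \<Longrightarrow> C_k_on k S (\<lambda>x. f x *\<^sub>R g x)"
proof (induction k arbitrary: f g)
  case 0
  then show ?case by (auto intro: continuous_intros)
next
  case (Suc k)
  then obtain f' g' where "\<forall>x\<in>S. (f has_derivative f' x) (at x)" "\<forall>v. C_k_on k S (\<lambda>x. f' x v)"
    "\<forall>x\<in>S. (g has_derivative g' x) (at x)" "\<forall>v. C_k_on k S (\<lambda>x. g' x v)"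
    by auto
  moreover have "C_k_on k S f" "C_k_on k S g" using Suc.prems by (blast intro: C_k_on_Suc_D)+
  ultimately show ?case
    unfolding C_k_on.simps
    by (intro exI[of _ "\<lambda>x v. f x *\<^sub>R g' x v + f' x v *\<^sub>R g x"])
      (auto intro!: has_derivative_scaleR C_k_on_add Suc.IH)
qed

text \<open>\<open>C_k_on\<close> tests derivatives only along a fixed vector, whereas the chain
  rule yields \<open>f' (g x) (g' x v)\<close>, whose direction moves with \<open>x\<close>.
  Expanding \<open>g' x v\<close> in \<open>Basis\<close> leaves fixed directions with scalar
  coefficients, where the product rule and the induction hypothesis apply.\<close>

lemma C_k_on_compose:
  fixes g :: "'e::euclidean_space \<Rightarrow> 'f::euclidean_space" and f :: "'f \<Rightarrow> 'h::euclidean_space"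
  shows "C_k_on k T f \<Longrightarrow> C_k_on k S g \<Longrightarrow> g ` S \<subseteq> T \<Longrightarrow> C_k_on k S (\<lambda>x. f (g x))"
proof (induction k arbitrary: f)
  case 0
  then show ?case by (auto intro: continuous_on_compose2)
next
  case (Suc k)
  then obtain f' g' where f': "\<forall>x\<in>T. (f has_derivative f' x) (at x)" "\<forall>v. C_k_on k T (\<lambda>x. f' x v)"
    and g': "\<forall>x\<in>S. (g has_derivative g' x) (at x)" "\<forall>v. C_k_on k S (\<lambda>x. g' x v)"
    by auto
  let ?D = "\<lambda>x v. \<Sum>b\<in>Basis. (g' x v \<bullet> b) *\<^sub>R f' (g x) b"
  have "((\<lambda>x. f (g x)) has_derivative ?D x) (at x)" if "x \<in> S" for x
  proof -
    have fx: "(f has_derivative f' (g x)) (at (g x))" using f'(1) Suc.prems(3) that by auto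
    have gx: "(g has_derivative g' x) (at x)" using g' that by auto
    have lin: "linear (f' (g x))" using fx has_derivative_linear by blast
    have "f' (g x) (g' x v) = ?D x v" for v
    proof -
      have "f' (g x) (g' x v) = f' (g x) (\<Sum>b\<in>Basis. (g' x v \<bullet> b) *\<^sub>R b)"
        by (simp add: euclidean_representation)
      also have "\<dots> = ?D x v"
        by (simp add: linear_sum[OF lin] linear_cmul[OF lin])
      finally show ?thesis .
    qed
    then show ?thesis
      using has_derivative_compose[OF gx fx] by simp
  qed
  moreover have "C_k_on k S (\<lambda>x. ?D x v)" for v :: 'e
  proof (intro C_k_on_sum C_k_on_scaleR C_k_on_inner finite_Basis)
    show "C_k_on k S (\<lambda>x. g' x v)" using g' by blast
    show "C_k_on k S (\<lambda>x. f' (g x) b)" for b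
      using Suc.IH f'(2) C_k_on_Suc_D[OF Suc.prems(2)] Suc.prems(3) by blast
  qed
  ultimately show ?case unfolding C_k_on.simps by (intro exI[of _ ?D]) blast
qed

text \<open>The image of one chart domain under \<open>F\<close> may meet many charts of
  \<open>B\<close>, so \<open>f\<close> after \<open>F\<close> is factored through a chart of
  \<open>B\<close> only near each point.\<close>

lemma smooth_function_compose:
  assumes A: "smooth_atlas A" and B: "smooth_atlas B"
    and F: "smooth_map A B F" and f: "smooth_function B f"
  shows "smooth_function A (\<lambda>p. f (F p))"
  unfolding smooth_map_def
proof (intro conjI ballI, goal_cases)
  case 1
  show ?case using F f unfolding smooth_map_def by (auto intro: continuous_on_compose2)
next
  case (2 c)
  obtain U \<phi> where c: "c = (U, \<phi>)" by force
  with 2 have U: "(U, \<phi>) \<in> A" by simp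
  then have ch: "open U" "open (\<phi> ` U)" "homeomorphism U (\<phi> ` U) \<phi> (inv_into U \<phi>)"
    using A unfolding smooth_atlas_def chart_def by auto
  have "C_k_on k (\<phi> ` U) (\<lambda>x. f (F (inv_into U \<phi> x)))" for k
  proof (rule C_k_on_local)
    fix x assume "x \<in> \<phi> ` U"
    then obtain p where p: "p \<in> U" "x = \<phi> p" by auto
    from B have "F p \<in> \<Union> (fst ` B)" unfolding smooth_atlas_def by auto
    then obtain V \<psi> where V: "(V, \<psi>) \<in> B" "F p \<in> V" by auto
    then have "open V" and hV: "homeomorphism V (\<psi> ` V) \<psi> (inv_into V \<psi>)"
      using B unfolding smooth_atlas_def chart_def by auto
    \<comment> \<open>The coordinates of the part of \<open>U\<close> that \<open>F\<close> sends
      into \<open>V\<close>. It is open because \<open>F\<close> is continuous and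
      \<open>\<phi>\<close> is a homeomorphism onto an open set.\<close>
    let ?S = "\<phi> ` (U \<inter> F -` V)"
    have "open (F -` V)"
      using F \<open>open V\<close> unfolding smooth_map_def by (auto simp: continuous_on_open_vimage)
    then have "openin (top_of_set U) (U \<inter> F -` V)" by (simp add: openin_open_Int)
    then have "openin (top_of_set (\<phi> ` U)) ?S"
      using homeomorphism_imp_open_map[OF ch(3)] by blast
    then have oS: "open ?S" using ch(2) openin_open_trans by blast
    have g: "C_k_on k ?S (\<lambda>x. \<psi> (F (inv_into U \<phi> x)))"
      using F U V unfolding smooth_map_def smooth_on_def by (fastforce simp: comp_def)
    have h: "C_k_on k (\<psi> ` V) (\<lambda>y. f (inv_into V \<psi> y))"
      using f V unfolding smooth_map_def smooth_on_def real_atlas_def by (fastforce simp: comp_def)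
    have inv: "inv_into U \<phi> (\<phi> q) = q" if "q \<in> U" for q
      using ch(3) that by (simp add: homeomorphism_def)
    have "C_k_on k ?S (\<lambda>x. f (inv_into V \<psi> (\<psi> (F (inv_into U \<phi> x)))))"
      by (rule C_k_on_compose[OF h g]) (auto simp: inv)
    then have "C_k_on k ?S (\<lambda>x. f (F (inv_into U \<phi> x)))"
      by (rule C_k_on_cong[OF oS, rotated]) (use hV in \<open>auto simp: inv homeomorphism_def\<close>)
    then show "\<exists>T. open T \<and> x \<in> T \<and> C_k_on k T (\<lambda>x. f (F (inv_into U \<phi> x)))"
      using oS p V by blast
  qed
  then show ?case
    by (auto simp: c real_atlas_def smooth_on_def comp_def)
qed

section \<open>Isomorphic Lie groups have isomorphic Lie algebras\<close>

text \<open>Transport of operators on functions along \<open>F\<close>. The inverse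
  \<open>F'\<close> is a separate argument so that exchanging the two gives the transport
  back.\<close>

definition pushforward :: "('m \<Rightarrow> 'n) \<Rightarrow> ('n \<Rightarrow> 'm) \<Rightarrow> (('m \<Rightarrow> real) \<Rightarrow> ('m \<Rightarrow> real)) \<Rightarrow> (('n \<Rightarrow> real) \<Rightarrow> ('n \<Rightarrow> real))"
  where "pushforward F F' D = (\<lambda>f q. D (\<lambda>p. f (F p)) (F' q))"

text \<open>Composition with \<open>F\<close> turns left translation by \<open>h\<close> in
  \<open>H\<close> into left translation by \<open>F' h\<close> in \<open>G\<close>, where the
  invariance of \<open>D\<close> applies.\<close>

lemma pushforward_left_invariant:
  assumes G: "lie_group G A" and H: "lie_group H B"
    and F: "smooth_map A B F" and F': "smooth_map B A F'"
    and inv: "\<And>p. F' (F p) = p" "\<And>q. F (F' q) = q"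
    and hom: "\<And>p q. F (p \<otimes>\<^bsub>G\<^esub> q) = F p \<otimes>\<^bsub>H\<^esub> F q"
    and D: "D \<in> left_invariant_fields G A"
  shows "pushforward F F' D \<in> left_invariant_fields H B"
proof -
  have AB: "smooth_atlas A" "smooth_atlas B" using G H unfolding lie_group_def by auto
  have pull: "smooth_function A (\<lambda>p. f (F p))" if "smooth_function B f" for f
    using smooth_function_compose[OF AB F that] .
  have pull': "smooth_function B (\<lambda>p. f (F' p))" if "smooth_function A f" for f
    using smooth_function_compose[OF AB(2,1) F' that] .
  \<comment> \<open>The convention that fields vanish on non-smooth functions has to survive the
    transport.\<close>
  have nonsm: "\<not> smooth_function A (\<lambda>p. f (F p))" if "\<not> smooth_function B f" for f
    using pull'[of "\<lambda>p. f (F p)"] that by (auto simp: inv)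
  have vf: "vector_field A D"
    and li: "\<And>g f. smooth_function A f \<Longrightarrow> D (\<lambda>p. f (g \<otimes>\<^bsub>G\<^esub> p)) = (\<lambda>p. D f (g \<otimes>\<^bsub>G\<^esub> p))"
    using D unfolding left_invariant_fields_def by auto
  have hom': "F' (h \<otimes>\<^bsub>H\<^esub> q) = F' h \<otimes>\<^bsub>G\<^esub> F' q" for h q
    by (metis hom inv)
  have "vector_field B (pushforward F F' D)"
    using vf unfolding vector_field_def pushforward_def
    by (auto simp: pull nonsm inv intro!: pull')
  moreover have "pushforward F F' D (\<lambda>q. f (h \<otimes>\<^bsub>H\<^esub> q)) = (\<lambda>q. pushforward F F' D f (h \<otimes>\<^bsub>H\<^esub> q))"
    if "smooth_function B f" for f h
    using li[OF pull[OF that], of "F' h"] unfolding pushforward_def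
    by (simp add: hom hom' inv)
  ultimately show ?thesis unfolding left_invariant_fields_def by auto
qed

lemma isomorphic_lie_groups_lie_algebra_iso:
  fixes brG :: "'k::real_vector \<Rightarrow> 'k \<Rightarrow> 'k" and brH :: "'l::real_vector \<Rightarrow> 'l \<Rightarrow> 'l"
  assumes G: "lie_group G A" and H: "lie_group H B"
    and iso: "isomorphic_lie_groups G A H B"
    and algG: "has_lie_algebra G A brG" and algH: "has_lie_algebra H B brH"
  obtains \<psi> where "linear \<psi>" "bij \<psi>" "\<And>x y. \<psi> (brG x y) = brH (\<psi> x) (\<psi> y)"
proof -
  obtain F where F: "F \<in> iso G H" "smooth_map A B F" "smooth_map B A (inv_into (carrier G) F)"
    using iso unfolding isomorphic_lie_groups_def by auto
  have carr: "carrier G = UNIV" "carrier H = UNIV" using G H unfolding lie_group_def by auto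
  define F' where "F' = inv_into (carrier G) F"
  have "bij F" and hom: "\<And>p q. F (p \<otimes>\<^bsub>G\<^esub> q) = F p \<otimes>\<^bsub>H\<^esub> F q"
    using F(1) carr unfolding iso_def hom_def by auto
  then have inv: "F' (F p) = p" "F (F' q) = q" for p q
    unfolding F'_def carr by (auto simp: bij_is_inj bij_is_surj surj_f_inv_f)
  have hom': "F' (h \<otimes>\<^bsub>H\<^esub> q) = F' h \<otimes>\<^bsub>G\<^esub> F' q" for h q
    by (metis hom inv)
  let ?P = "pushforward F F'" and ?Q = "pushforward F' F"
  have P: "?P D \<in> left_invariant_fields H B" if "D \<in> left_invariant_fields G A" for D
    using pushforward_left_invariant[OF G H F(2) F(3)[folded F'_def] inv hom that] .
  have Q: "?Q D \<in> left_invariant_fields G A" if "D \<in> left_invariant_fields H B" for D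
    using pushforward_left_invariant[OF H G F(3)[folded F'_def] F(2) inv(2,1) hom' that] .
  have PQ: "?P (?Q D) = D" "?Q (?P E) = E" for D E
    by (simp_all add: pushforward_def inv)
  have bijP: "bij_betw ?P (left_invariant_fields G A) (left_invariant_fields H B)"
    by (rule bij_betw_byWitness[of _ ?Q]) (auto simp: PQ P Q)
  obtain \<Theta> where \<Theta>: "bij_betw \<Theta> UNIV (left_invariant_fields G A)"
      "\<And>x y. \<Theta> (x + y) = (\<lambda>f p. \<Theta> x f p + \<Theta> y f p)"
      "\<And>c x. \<Theta> (c *\<^sub>R x) = (\<lambda>f p. c * \<Theta> x f p)"
      "\<And>x y. \<Theta> (brG x y) = commutator (\<Theta> x) (\<Theta> y)"
    using algG unfolding has_lie_algebra_def by auto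
  obtain \<Xi> where \<Xi>: "bij_betw \<Xi> UNIV (left_invariant_fields H B)"
      "\<And>x y. \<Xi> (x + y) = (\<lambda>f p. \<Xi> x f p + \<Xi> y f p)"
      "\<And>c x. \<Xi> (c *\<^sub>R x) = (\<lambda>f p. c * \<Xi> x f p)"
      "\<And>x y. \<Xi> (brH x y) = commutator (\<Xi> x) (\<Xi> y)"
    using algH unfolding has_lie_algebra_def by auto
  \<comment> \<open>The pushforward read through the two identifications \<open>\<Theta>\<close> and
    \<open>\<Xi>\<close>. Linearity and compatibility with brackets are then checked on operators,
    using that \<open>\<Xi>\<close> is injective.\<close>
  define \<psi> where "\<psi> = inv_into UNIV \<Xi> \<circ> (?P \<circ> \<Theta>)"
  have "bij_betw (?P \<circ> \<Theta>) UNIV (left_invariant_fields H B)"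
    using \<Theta>(1) bijP by (rule bij_betw_trans)
  moreover have "bij_betw (inv_into UNIV \<Xi>) (left_invariant_fields H B) UNIV"
    using \<Xi>(1) by (rule bij_betw_inv_into)
  ultimately have bij: "bij \<psi>" unfolding \<psi>_def by (rule bij_betw_trans)
  have \<psi>: "\<Xi> (\<psi> x) = ?P (\<Theta> x)" for x
  proof -
    have "?P (\<Theta> x) \<in> range \<Xi>"
      using P \<Theta>(1) \<Xi>(1) by (metis bij_betw_def rangeI)
    then show ?thesis unfolding \<psi>_def by (simp add: f_inv_into_f)
  qed
  have \<Xi>_inj: "x = y" if "\<Xi> x = \<Xi> y" for x y
    using \<Xi>(1) that by (auto simp: bij_betw_def dest: injD)
  show thesis
  proof (rule that[OF _ bij])
    show "linear \<psi>"
      by (rule linearI; rule \<Xi>_inj; simp add: \<psi> \<Theta> \<Xi> pushforward_def)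
    show "\<psi> (brG x y) = brH (\<psi> x) (\<psi> y)" for x y
      by (rule \<Xi>_inj) (simp add: \<psi> \<Theta> \<Xi> pushforward_def commutator_def inv)
  qed
qed

section \<open>Perturbing a grading derivation by an inner derivation\<close>

locale weight_basis =
  fixes B :: "'a::real_vector set" and wt :: "'a \<Rightarrow> real"
  assumes finite_B: "finite B" and independent_B: "independent B" and span_B: "span B = UNIV"
begin

text \<open>A predicate on weights covers both the weight spaces (\<open>\<nu> = \<sigma>\<close>)
  and the descending filtration (\<open>\<sigma> < \<nu>\<close>).\<close>

definition wspan :: "(real \<Rightarrow> bool) \<Rightarrow> 'a set" where
  "wspan P = span {b\<in>B. P (wt b)}"

lemma subspace_wspan: "subspace (wspan P)"
  by (simp add: wspan_def)

lemma wspan_base: "b \<in> B \<Longrightarrow> P (wt b) \<Longrightarrow> b \<in> wspan P"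
  unfolding wspan_def by (rule span_base) simp

lemma wspan_mono: "x \<in> wspan P \<Longrightarrow> (\<And>\<nu>. P \<nu> \<Longrightarrow> Q \<nu>) \<Longrightarrow> x \<in> wspan Q"
  using span_mono[of "{b\<in>B. P (wt b)}" "{b\<in>B. Q (wt b)}"] unfolding wspan_def by auto

lemma wspan_total: "(\<And>b. b \<in> B \<Longrightarrow> P (wt b)) \<Longrightarrow> x \<in> wspan P"
proof -
  assume "\<And>b. b \<in> B \<Longrightarrow> P (wt b)"
  then have "{b\<in>B. P (wt b)} = B" by auto
  then show ?thesis using span_B by (simp add: wspan_def)
qed

lemma linear_image_wspan:
  assumes "x \<in> wspan P" "linear T" "subspace W" "\<And>b. b \<in> B \<Longrightarrow> P (wt b) \<Longrightarrow> T b \<in> W"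
  shows "T x \<in> W"
  using assms(1) unfolding wspan_def
proof (induction rule: span_induct)
  case base
  show ?case
    using linear_subspace_vimage[OF assms(2,3)] by (simp add: vimage_def)
qed (use assms(4) in auto)

text \<open>Ordered by weight, \<open>T\<close> is block triangular with nonzero scalars
  \<open>k \<nu>\<close> on the diagonal. The induction removes the lowest weight above
  \<open>\<rho>\<close>.\<close>

lemma triangular_bijective:
  assumes T: "linear T"
    and tri: "\<And>b. b \<in> B \<Longrightarrow> \<rho> < wt b \<Longrightarrow> T b - k (wt b) *\<^sub>R b \<in> wspan (\<lambda>\<nu>. wt b < \<nu>)"
    and k: "\<And>\<nu>. \<rho> < \<nu> \<Longrightarrow> k \<nu> \<noteq> 0"
  shows "(\<forall>x\<in>wspan (\<lambda>\<nu>. \<rho> < \<nu>). T x = 0 \<longrightarrow> x = 0) \<and>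
         (\<forall>y\<in>wspan (\<lambda>\<nu>. \<rho> < \<nu>). \<exists>x\<in>wspan (\<lambda>\<nu>. \<rho> < \<nu>). T x = y)"
  using tri k
proof (induction "card {b\<in>B. \<rho> < wt b}" arbitrary: \<rho> rule: less_induct)
  case less
  show ?case
  proof (cases "{b\<in>B. \<rho> < wt b} = {}")
    case True
    then have "wspan (\<lambda>\<nu>. \<rho> < \<nu>) = {0}" unfolding wspan_def by (simp only: span_empty)
    then show ?thesis by (simp add: linear_0[OF T])
  next
    case False
    define \<nu> where "\<nu> = Min (wt ` {b\<in>B. \<rho> < wt b})"
    have fin: "finite (wt ` {b\<in>B. \<rho> < wt b})" using finite_B by simp
    then have "\<nu> \<in> wt ` {b\<in>B. \<rho> < wt b}" unfolding \<nu>_def using False by (intro Min_in) auto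
    then obtain b0 where b0: "b0 \<in> B" "wt b0 = \<nu>" and \<rho>\<nu>: "\<rho> < \<nu>" by auto
    have min: "\<nu> \<le> wt b" if "b \<in> B" "\<rho> < wt b" for b
      unfolding \<nu>_def using that fin by (intro Min_le) auto
    have "{b\<in>B. \<nu> < wt b} \<subset> {b\<in>B. \<rho> < wt b}" using b0 \<rho>\<nu> by force
    then have "card {b\<in>B. \<nu> < wt b} < card {b\<in>B. \<rho> < wt b}"
      using finite_B by (intro psubset_card_mono) auto
    then have IH: "x \<in> wspan (\<lambda>\<mu>. \<nu> < \<mu>) \<Longrightarrow> T x = 0 \<Longrightarrow> x = 0"
      "y \<in> wspan (\<lambda>\<mu>. \<nu> < \<mu>) \<Longrightarrow> \<exists>x\<in>wspan (\<lambda>\<mu>. \<nu> < \<mu>). T x = y" for x y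
      using less.hyps[of \<nu>] less.prems \<rho>\<nu> by auto
    \<comment> \<open>On the subspace above \<open>\<rho>\<close>, \<open>T\<close> is
      multiplication by \<open>k \<nu>\<close> up to an error in the next smaller subspace, where
      the induction hypothesis holds.\<close>
    have step: "T x - k \<nu> *\<^sub>R x \<in> wspan (\<lambda>\<mu>. \<nu> < \<mu>)" if "x \<in> wspan (\<lambda>\<mu>. \<rho> < \<mu>)" for x
    proof (rule linear_image_wspan[OF that, of "\<lambda>x. T x - k \<nu> *\<^sub>R x"])
      show "linear (\<lambda>x. T x - k \<nu> *\<^sub>R x)"
        by (intro linear_compose_sub T linear_scale_self)
      fix b assume b: "b \<in> B" "\<rho> < wt b"
      then have t: "T b - k (wt b) *\<^sub>R b \<in> wspan (\<lambda>\<mu>. wt b < \<mu>)" using less.prems by blast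
      show "T b - k \<nu> *\<^sub>R b \<in> wspan (\<lambda>\<mu>. \<nu> < \<mu>)"
      proof (cases "wt b = \<nu>")
        case True
        then show ?thesis using t by simp
      next
        case False
        then have "\<nu> < wt b" using min[OF b] by simp
        then have "T b - k (wt b) *\<^sub>R b \<in> wspan (\<lambda>\<mu>. \<nu> < \<mu>)" "b \<in> wspan (\<lambda>\<mu>. \<nu> < \<mu>)"
          using wspan_mono[OF t] wspan_base b(1) by auto
        then have "(T b - k (wt b) *\<^sub>R b) + (k (wt b) - k \<nu>) *\<^sub>R b \<in> wspan (\<lambda>\<mu>. \<nu> < \<mu>)"
          by (intro subspace_add subspace_scale subspace_wspan)
        then show ?thesis by (simp add: algebra_simps)
      qed
    qed (rule subspace_wspan)
    have k\<nu>: "k \<nu> \<noteq> 0" using less.prems \<rho>\<nu> by blast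
    have "x = 0" if x: "x \<in> wspan (\<lambda>\<mu>. \<rho> < \<mu>)" "T x = 0" for x
    proof (rule IH(1)[OF _ x(2)])
      have "(- 1 / k \<nu>) *\<^sub>R (T x - k \<nu> *\<^sub>R x) \<in> wspan (\<lambda>\<mu>. \<nu> < \<mu>)"
        by (intro subspace_scale subspace_wspan step x)
      then show "x \<in> wspan (\<lambda>\<mu>. \<nu> < \<mu>)" using k\<nu> x(2) by simp
    qed
    moreover have "\<exists>x\<in>wspan (\<lambda>\<mu>. \<rho> < \<mu>). T x = y" if y: "y \<in> wspan (\<lambda>\<mu>. \<rho> < \<mu>)" for y
    proof -
      \<comment> \<open>Correcting \<open>y\<close> by a preimage \<open>z\<close> of the error
        gives \<open>T (y - z) = k \<nu> *\<^sub>R y\<close>.\<close>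
      obtain z where z: "z \<in> wspan (\<lambda>\<mu>. \<nu> < \<mu>)" "T z = T y - k \<nu> *\<^sub>R y"
        using IH(2)[OF step[OF y]] by auto
      have "z \<in> wspan (\<lambda>\<mu>. \<rho> < \<mu>)" using wspan_mono[OF z(1)] \<rho>\<nu> by auto
      then have "(1 / k \<nu>) *\<^sub>R (y - z) \<in> wspan (\<lambda>\<mu>. \<rho> < \<mu>)"
        by (intro subspace_scale subspace_diff subspace_wspan y)
      moreover have "T ((1 / k \<nu>) *\<^sub>R (y - z)) = y"
        using k\<nu> by (simp add: linear_cmul[OF T] linear_diff[OF T] z(2))
      ultimately show ?thesis by blast
    qed
    ultimately show ?thesis by blast
  qed
qed

text \<open>Comparing coefficients in the basis kills those at weights other than
  \<open>\<sigma>\<close>. This locates brackets of basis vectors, which need not be basis vectors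
  themselves.\<close>

lemma eigenvector_in_wspan:
  assumes "linear \<beta>" and \<beta>: "\<And>b. b \<in> B \<Longrightarrow> \<beta> b = wt b *\<^sub>R b" and x: "\<beta> x = \<sigma> *\<^sub>R x"
  shows "x \<in> wspan (\<lambda>\<nu>. \<nu> = \<sigma>)"
proof -
  have "x \<in> range (\<lambda>r. \<Sum>b\<in>B. r b *\<^sub>R b)"
    using span_B span_finite[OF finite_B] by simp
  then obtain r where r: "x = (\<Sum>b\<in>B. r b *\<^sub>R b)" by blast
  have "\<beta> x = (\<Sum>b\<in>B. (r b * wt b) *\<^sub>R b)"
    unfolding r by (simp add: linear_sum[OF assms(1)] linear_cmul[OF assms(1)] \<beta>)
  then have "(\<Sum>b\<in>B. (r b * (wt b - \<sigma>)) *\<^sub>R b) = \<beta> x - \<sigma> *\<^sub>R x"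
    unfolding r by (simp add: scaleR_sum_right sum_subtractf[symmetric] algebra_simps)
  then have zero: "r b * (wt b - \<sigma>) = 0" if "b \<in> B" for b
    using independentD[OF independent_B finite_B subset_refl, of "\<lambda>b. r b * (wt b - \<sigma>)" b] that x by simp
  have "r b *\<^sub>R b \<in> wspan (\<lambda>\<nu>. \<nu> = \<sigma>)" if "b \<in> B" for b
    using that zero[OF that] by (cases "wt b = \<sigma>")
      (auto intro: subspace_scale[OF subspace_wspan] wspan_base subspace_0[OF subspace_wspan])
  then show ?thesis unfolding r by (intro subspace_sum subspace_wspan)
qed

end

section \<open>Brackets and weights for a derivation with positive weights\<close>

locale graded_lie_algebra = weight_basis B wt
  for B :: "'a::real_vector set" and wt +
  fixes br :: "'a \<Rightarrow> 'a \<Rightarrow> 'a" and \<beta> :: "'a \<Rightarrow> 'a"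
  assumes lie: "lie_bracket br" and der: "derivation br \<beta>"
    and eigen: "\<And>b. b \<in> B \<Longrightarrow> \<beta> b = wt b *\<^sub>R b"
    and wt_pos: "\<And>b. b \<in> B \<Longrightarrow> 0 < wt b"
begin

lemma bilinear_br: "bilinear br"
  using lie by (simp add: lie_bracket_def)

lemma linear_br_left: "linear (\<lambda>x. br x y)" and linear_br_right: "linear (br x)"
  using bilinear_br by (auto simp: bilinear_def)

lemma linear_\<beta>: "linear \<beta>" and derivation_\<beta>: "\<beta> (br x y) = br (\<beta> x) y + br x (\<beta> y)"
  using der by (auto simp: derivation_def)

text \<open>By the Leibniz rule the bracket of two basis vectors is an eigenvector of
  \<open>\<beta>\<close> for the sum of their weights; bilinearity does the rest.\<close>

lemma br_wspan:
  assumes x: "x \<in> wspan P" and y: "y \<in> wspan Q" and PQ: "\<And>\<mu> \<nu>. P \<mu> \<Longrightarrow> Q \<nu> \<Longrightarrow> R (\<mu> + \<nu>)"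
  shows "br x y \<in> wspan R"
proof (rule linear_image_wspan[OF x linear_br_left subspace_wspan],
    rule linear_image_wspan[OF y linear_br_right subspace_wspan])
  fix a b assume *: "a \<in> B" "P (wt a)" "b \<in> B" "Q (wt b)"
  have "\<beta> (br a b) = (wt a + wt b) *\<^sub>R br a b"
    using * by (simp add: derivation_\<beta> eigen linear_cmul[OF linear_br_left]
        linear_cmul[OF linear_br_right] scaleR_left_distrib)
  then have "br a b \<in> wspan (\<lambda>\<nu>. \<nu> = wt a + wt b)"
    using eigenvector_in_wspan linear_\<beta> eigen by blast
  then show "br a b \<in> wspan R" by (rule wspan_mono) (use PQ * in auto)
qed

text \<open>This is the Jacobi identity rewritten by antisymmetry, which comes from expanding
  \<open>br (x + z) (x + z) = 0\<close>.\<close>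

lemma ad_derivation: "br y (br u v) = br (br y u) v + br u (br y v)"
proof -
  have sq: "br x x = 0" for x using lie by (simp add: lie_bracket_def)
  have anti: "br x z = - br z x" for x z
  proof -
    have "br x z + br z x = 0"
      using sq[of "x + z"]
      by (simp add: linear_add[OF linear_br_left] linear_add[OF linear_br_right] sq[of x] sq[of z] add.commute)
    then show ?thesis by (simp add: eq_neg_iff_add_eq_0)
  qed
  have "br y (br u v) + br u (br v y) + br v (br y u) = 0"
    using lie by (auto simp: lie_bracket_def)
  moreover have "br u (br v y) = - br u (br y v)"
    by (subst anti[of v y]) (simp add: linear_neg[OF linear_br_right])
  moreover have "br v (br y u) = - br (br y u) v" by (rule anti)
  ultimately show ?thesis by (simp add: algebra_simps)
qed

text \<open>Modulo higher weights, the perturbed derivation still acts as \<open>c \<beta>\<close>, so each basis vector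
  \<open>b\<close> of weight \<open>\<mu>\<close> is the leading term of exactly one eigenvector for \<open>c \<mu>\<close>. Sending \<open>b\<close> to
  this eigenvector defines the automorphism, and uniqueness makes it multiplicative.\<close>

lemma perturbed_derivation_conjugate:
  assumes c: "c \<noteq> 0"
  obtains \<Phi> where "lie_automorphism br \<Phi>"
    "\<And>x. br y (\<Phi> x) + c *\<^sub>R \<beta> (\<Phi> x) = \<Phi> (c *\<^sub>R \<beta> x)"
proof -
  define D where "D x = br y x + c *\<^sub>R \<beta> x" for x
  have linD: "linear D" unfolding D_def
    by (intro linear_compose_add linear_br_right linear_compose_scale_right linear_\<beta>)
  have derD: "D (br u v) = br (D u) v + br u (D v)" for u v
    unfolding D_def
    by (simp add: ad_derivation[of y] derivation_\<beta> linear_add[OF linear_br_left] linear_add[OF linear_br_right]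
        linear_cmul[OF linear_br_left] linear_cmul[OF linear_br_right] algebra_simps)
  \<comment> \<open>All weights occurring in \<open>y\<close> are positive, so bracketing with
    \<open>y\<close> strictly raises weights.\<close>
  have ady: "br y b \<in> wspan (\<lambda>\<nu>. wt b < \<nu>)" if "b \<in> B" for b
  proof (rule br_wspan)
    show "y \<in> wspan (\<lambda>\<nu>. 0 < \<nu>)" by (rule wspan_total) (rule wt_pos)
    show "b \<in> wspan (\<lambda>\<nu>. \<nu> = wt b)" by (rule wspan_base) (use that in auto)
  qed auto
  \<comment> \<open>On weights \<open>\<nu> > \<mu>\<close> the leading coefficient of
    \<open>D\<close> minus \<open>c * \<mu>\<close> is \<open>c * (\<nu> - \<mu>)\<close>, which is
    nonzero. Surjectivity will give existence of the eigenvectors, injectivity their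
    uniqueness.\<close>
  have shifted: "(\<forall>x\<in>wspan (\<lambda>\<nu>. \<mu> < \<nu>). D x - (c * \<mu>) *\<^sub>R x = 0 \<longrightarrow> x = 0) \<and>
      (\<forall>w\<in>wspan (\<lambda>\<nu>. \<mu> < \<nu>). \<exists>x\<in>wspan (\<lambda>\<nu>. \<mu> < \<nu>). D x - (c * \<mu>) *\<^sub>R x = w)" for \<mu>
  proof (rule triangular_bijective[where k = "\<lambda>\<nu>. c * (\<nu> - \<mu>)"])
    show "linear (\<lambda>x. D x - (c * \<mu>) *\<^sub>R x)"
      by (intro linear_compose_sub linD linear_scale_self)
    show "D b - (c * \<mu>) *\<^sub>R b - (c * (wt b - \<mu>)) *\<^sub>R b \<in> wspan (\<lambda>\<nu>. wt b < \<nu>)" if "b \<in> B" for b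
      using ady[OF that] that by (simp add: D_def eigen algebra_simps)
  qed (use c in auto)
  have "\<exists>w. w - b \<in> wspan (\<lambda>\<nu>. wt b < \<nu>) \<and> D w = (c * wt b) *\<^sub>R w" if b: "b \<in> B" for b
  proof -
    \<comment> \<open>With the ansatz \<open>b + z\<close> the eigenvector equation becomes this
      one, because \<open>D b - (c * wt b) *\<^sub>R b = br y b\<close>.\<close>
    obtain z where z: "z \<in> wspan (\<lambda>\<nu>. wt b < \<nu>)" "D z - (c * wt b) *\<^sub>R z = - br y b"
      using shifted[of "wt b"] ady[OF b] subspace_neg[OF subspace_wspan] by blast
    have "D (b + z) = (c * wt b) *\<^sub>R (b + z)"
      using z(2) b by (simp add: linear_add[OF linD] D_def[of b] eigen algebra_simps)
    then show ?thesis using z(1) by (intro exI[of _ "b + z"]) simp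
  qed
  then obtain lift where lift: "\<And>b. b \<in> B \<Longrightarrow> lift b - b \<in> wspan (\<lambda>\<nu>. wt b < \<nu>)"
    "\<And>b. b \<in> B \<Longrightarrow> D (lift b) = (c * wt b) *\<^sub>R lift b"
    by metis
  obtain \<Phi> where lin\<Phi>: "linear \<Phi>" and \<Phi>: "\<And>b. b \<in> B \<Longrightarrow> \<Phi> b = lift b"
    using linear_independent_extend[OF independent_B] by blast
  have ext: "f x = g x" if "linear f" "linear g" "\<And>b. b \<in> B \<Longrightarrow> f b = g b" for f g :: "'a \<Rightarrow> 'a" and x
    using linear_eq_on_span[of f g B x] that span_B by auto
  have D\<Phi>: "D (\<Phi> x) = \<Phi> (c *\<^sub>R \<beta> x)" for x
    by (rule ext[of "\<lambda>x. D (\<Phi> x)" "\<lambda>x. \<Phi> (c *\<^sub>R \<beta> x)"])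
      (use linear_compose[OF lin\<Phi> linD]
        linear_compose[OF linear_compose_scale_right[OF linear_\<beta>, of c] lin\<Phi>] in
        \<open>auto simp: comp_def \<Phi> lift eigen linear_cmul[OF lin\<Phi>]\<close>)
  have all: "x \<in> wspan (\<lambda>\<nu>. 0 < \<nu>)" for x by (rule wspan_total) (rule wt_pos)
  \<comment> \<open>\<open>\<Phi>\<close> is unitriangular, and the subspace above weight 0 is the
    whole space.\<close>
  have "(\<forall>x\<in>wspan (\<lambda>\<nu>. 0 < \<nu>). \<Phi> x = 0 \<longrightarrow> x = 0) \<and>
      (\<forall>w\<in>wspan (\<lambda>\<nu>. 0 < \<nu>). \<exists>x\<in>wspan (\<lambda>\<nu>. 0 < \<nu>). \<Phi> x = w)"
    by (rule triangular_bijective[where k = "\<lambda>_. 1"]) (auto simp: lin\<Phi> \<Phi> lift)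
  then have bij\<Phi>: "bij \<Phi>"
    using all by (auto simp: bij_def linear_injective_0[OF lin\<Phi>] surj_def) metis
  have lead: "\<Phi> x - x \<in> wspan (\<lambda>\<nu>. \<sigma> < \<nu>)" if "x \<in> wspan (\<lambda>\<nu>. \<nu> = \<sigma>)" for x \<sigma>
    by (rule linear_image_wspan[OF that, of "\<lambda>x. \<Phi> x - x"])
      (use lift in \<open>auto simp: \<Phi> intro!: linear_compose_sub lin\<Phi> linear_ident subspace_wspan\<close>)
  have basis: "\<Phi> (br a b) = br (\<Phi> a) (\<Phi> b)" if ab: "a \<in> B" "b \<in> B" for a b
  proof -
    let ?\<sigma> = "wt a + wt b"
    let ?W = "wspan (\<lambda>\<nu>. ?\<sigma> < \<nu>)"
    have \<beta>ab: "\<beta> (br a b) = ?\<sigma> *\<^sub>R br a b"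
      using ab by (simp add: derivation_\<beta> eigen linear_cmul[OF linear_br_left]
          linear_cmul[OF linear_br_right] scaleR_left_distrib)
    \<comment> \<open>Both terms are eigenvectors of \<open>D\<close> for
      \<open>c * ?\<sigma>\<close> with the same leading term \<open>br a b\<close>. Hence
      \<open>u\<close> is an eigenvector lying strictly above \<open>?\<sigma>\<close>, and
      \<open>shifted\<close> forces it to vanish.\<close>
    define u where "u = \<Phi> (br a b) - br (\<Phi> a) (\<Phi> b)"
    have "D u = (c * ?\<sigma>) *\<^sub>R u"
      using ab unfolding u_def
      by (simp add: linear_diff[OF linD] D\<Phi> \<beta>ab derD eigen linear_cmul[OF lin\<Phi>]
          linear_add[OF lin\<Phi>] linear_cmul[OF linear_br_left] linear_cmul[OF linear_br_right] algebra_simps)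
    moreover have "u \<in> ?W"
    proof -
      have "\<Phi> (br a b) - br a b \<in> ?W"
        using lead eigenvector_in_wspan[OF linear_\<beta> eigen \<beta>ab] by blast
      moreover have a: "a \<in> wspan (\<lambda>\<nu>. \<nu> = wt a)" and \<Phi>b: "\<Phi> b \<in> wspan (\<lambda>\<nu>. wt b \<le> \<nu>)"
      proof -
        show "a \<in> wspan (\<lambda>\<nu>. \<nu> = wt a)" by (rule wspan_base) (use ab in auto)
        have "\<Phi> b - b \<in> wspan (\<lambda>\<nu>. wt b \<le> \<nu>)"
          using lift(1)[OF ab(2)] by (auto simp: \<Phi> ab intro: wspan_mono)
        moreover have "b \<in> wspan (\<lambda>\<nu>. wt b \<le> \<nu>)" by (rule wspan_base) (use ab in auto)
        ultimately have "(\<Phi> b - b) + b \<in> wspan (\<lambda>\<nu>. wt b \<le> \<nu>)" by (rule subspace_add[OF subspace_wspan])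
        then show "\<Phi> b \<in> wspan (\<lambda>\<nu>. wt b \<le> \<nu>)" by simp
      qed
      moreover have "br (\<Phi> a - a) (\<Phi> b) \<in> ?W"
        by (rule br_wspan[OF lift(1)[OF ab(1), folded \<Phi>[OF ab(1)]] \<Phi>b]) auto
      moreover have "br a (\<Phi> b - b) \<in> ?W"
        by (rule br_wspan[OF a lift(1)[OF ab(2), folded \<Phi>[OF ab(2)]]]) auto
      \<comment> \<open>The sum telescopes: \<open>br (\<Phi> a) (\<Phi> b) - br a b\<close> is
        \<open>br (\<Phi> a - a) (\<Phi> b) + br a (\<Phi> b - b)\<close>.\<close>
      ultimately have "\<Phi> (br a b) - br a b - br (\<Phi> a - a) (\<Phi> b) - br a (\<Phi> b - b) \<in> ?W"
        by (blast intro: subspace_diff[OF subspace_wspan subspace_diff[OF subspace_wspan]])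
      then show ?thesis unfolding u_def
        by (simp add: linear_diff[OF linear_br_left] linear_diff[OF linear_br_right])
    qed
    ultimately have "u = 0" using shifted[of ?\<sigma>] by auto
    then show ?thesis by (simp add: u_def)
  qed
  have lin1: "linear (\<lambda>x. \<Phi> (br x v))" "linear (\<lambda>x. \<Phi> (br v x))"
    "linear (\<lambda>x. br (\<Phi> x) v)" "linear (\<lambda>x. br v (\<Phi> x))" for v
    using linear_compose[OF linear_br_left lin\<Phi>] linear_compose[OF linear_br_right lin\<Phi>]
      linear_compose[OF lin\<Phi> linear_br_left] linear_compose[OF lin\<Phi> linear_br_right]
    by (auto simp: comp_def)
  \<comment> \<open>Multiplicativity extends from the basis one argument at a time, first the second
    and then the first.\<close>
  have left: "\<Phi> (br a v) = br (\<Phi> a) (\<Phi> v)" if "a \<in> B" for a v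
    by (rule ext[of "\<lambda>x. \<Phi> (br a x)" "\<lambda>x. br (\<Phi> a) (\<Phi> x)"]) (use that basis lin1 in auto)
  have "\<Phi> (br u v) = br (\<Phi> u) (\<Phi> v)" for u v
    by (rule ext[of "\<lambda>x. \<Phi> (br x v)" "\<lambda>x. br (\<Phi> x) (\<Phi> v)"]) (use left lin1 in auto)
  with lin\<Phi> bij\<Phi> have "lie_automorphism br \<Phi>" by (simp add: lie_automorphism_def)
  then show thesis using that D\<Phi> unfolding D_def by blast
qed

end

section \<open>Isomorphisms between the semidirect products\<close>

lemma diagonalizable_positive_basis:
  fixes \<alpha> :: "'a::real_vector \<Rightarrow> 'a"
  assumes "finite_dimensional TYPE('a)" and "real_diagonalizable \<alpha>"
    and pos: "\<And>\<mu>. eigenvalue_of \<alpha> \<mu> \<Longrightarrow> \<mu> > 0"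
  obtains B wt where "weight_basis B" "\<And>b. b \<in> B \<Longrightarrow> \<alpha> b = wt b *\<^sub>R b" "\<And>b. b \<in> B \<Longrightarrow> 0 < wt b"
proof -
  obtain B wt where B: "independent B" "span B = UNIV" "\<And>b. b \<in> B \<Longrightarrow> \<alpha> b = wt b *\<^sub>R b"
    using assms(2) unfolding real_diagonalizable_def by metis
  obtain C :: "'a set" where C: "finite C" "span C = UNIV"
    using assms(1) unfolding finite_dimensional_def by auto
  have "finite B" using independent_span_bound[OF C(1) B(1)] C(2) by auto
  moreover have "0 < wt b" if "b \<in> B" for b
  proof (rule pos)
    have "b \<noteq> 0" using that B(1) dependent_zero by metis
    then show "eigenvalue_of \<alpha> (wt b)" using B(3)[OF that] by (auto simp: eigenvalue_of_def)
  qed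
  ultimately show thesis using that B unfolding weight_basis_def by blast
qed

text \<open>Each basis eigenvector \<open>b\<close> is the image of \<open>b\<close> divided by its
  nonzero weight.\<close>

lemma positive_diagonalizable_surj:
  fixes \<alpha> :: "'a::real_vector \<Rightarrow> 'a"
  assumes "finite_dimensional TYPE('a)" and "linear \<alpha>" and "real_diagonalizable \<alpha>"
    and pos: "\<And>\<mu>. eigenvalue_of \<alpha> \<mu> \<Longrightarrow> \<mu> > 0"
  shows "surj \<alpha>"
proof -
  obtain B wt where B: "weight_basis B" "\<And>b. b \<in> B \<Longrightarrow> \<alpha> b = wt b *\<^sub>R b" "\<And>b. b \<in> B \<Longrightarrow> 0 < wt b"
    using diagonalizable_positive_basis[OF assms(1,3) pos] by metis
  have "b \<in> range \<alpha>" if "b \<in> B" for b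
  proof -
    have "\<alpha> ((1 / wt b) *\<^sub>R b) = b" using B(2,3)[OF that] by (simp add: linear_cmul[OF assms(2)])
    then show ?thesis by (metis rangeI)
  qed
  moreover have "subspace (range \<alpha>)" using assms(2) by (simp add: linear_subspace_image)
  ultimately have "span B \<subseteq> range \<alpha>" by (intro span_minimal) auto
  then show ?thesis using B(1) by (auto simp: weight_basis_def)
qed

text \<open>As \<open>\<alpha>\<close> is surjective, \<open>X\<close> ranges over the derived algebra of the semidirect product.\<close>

lemma semidirect_hom_preserves_ideal:
  fixes br :: "'a::real_vector \<Rightarrow> 'a \<Rightarrow> 'a"
  assumes "lie_bracket br" and "surj \<alpha>"
    and hom: "\<And>x y. \<psi> (semidirect_bracket br \<alpha> x y) = semidirect_bracket br \<beta> (\<psi> x) (\<psi> y)"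
  shows "snd (\<psi> (X, 0)) = 0"
proof -
  obtain Z where Z: "X = \<alpha> Z" using assms(2) by (metis surjD)
  have "br 0 Z = 0" using assms(1) by (simp add: lie_bracket_def bilinear_lzero)
  \<comment> \<open>This is \<open>X = \<alpha> Z = [T, Z]\<close>. A homomorphism sends it to a
    bracket, and brackets have no \<open>T\<close> component.\<close>
  then have "(X, 0) = semidirect_bracket br \<alpha> (0, 1) (Z, 0)"
    by (simp add: semidirect_bracket_def Z)
  then have "\<psi> (X, 0) = semidirect_bracket br \<beta> (\<psi> (0, 1)) (\<psi> (Z, 0))" by (simp add: hom)
  then show ?thesis by (simp add: semidirect_bracket_def split: prod.splits)
qed

text \<open>Applying \<open>\<psi>\<close> to \<open>[T, x] = \<alpha> x\<close> gives
  \<open>[y + c T, \<phi> x]\<close>, which expands to the stated formula. Preservation of the ideal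
  by the inverse of \<open>\<psi>\<close> makes \<open>\<phi>\<close> surjective and
  \<open>c\<close> nonzero.\<close>

lemma semidirect_iso_restrict:
  fixes br :: "'a::real_vector \<Rightarrow> 'a \<Rightarrow> 'a"
  assumes lie: "lie_bracket br" and surj: "surj \<alpha>" "surj \<beta>" and lin: "linear \<alpha>" "linear \<beta>"
    and \<psi>: "linear \<psi>" "bij \<psi>"
    and hom: "\<And>x y. \<psi> (semidirect_bracket br \<alpha> x y) = semidirect_bracket br \<beta> (\<psi> x) (\<psi> y)"
  obtains \<phi> y c where "lie_automorphism br \<phi>" "c \<noteq> 0"
    "\<And>x. \<phi> (\<alpha> x) = br y (\<phi> x) + c *\<^sub>R \<beta> (\<phi> x)"
proof -
  define \<phi> where "\<phi> X = fst (\<psi> (X, 0))" for X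
  obtain y c where yc: "\<psi> (0, 1) = (y, c)" by force
  have \<psi>\<phi>: "\<psi> (X, 0) = (\<phi> X, 0)" for X
    using semidirect_hom_preserves_ideal[OF lie surj(1) hom] by (simp add: \<phi>_def prod_eq_iff)
  have inv: "inv_into UNIV \<psi> (\<psi> p) = p" "\<psi> (inv_into UNIV \<psi> p) = p" for p
    using \<psi>(2) by (auto simp: bij_is_inj bij_is_surj surj_f_inv_f)
  have hom': "inv_into UNIV \<psi> (semidirect_bracket br \<beta> x y) = semidirect_bracket br \<alpha> (inv_into UNIV \<psi> x) (inv_into UNIV \<psi> y)" for x y
    by (metis hom inv)
  have ideal': "snd (inv_into UNIV \<psi> (X, 0)) = 0" for X
    using semidirect_hom_preserves_ideal[OF lie surj(2) hom'] .
  have br0: "br 0 x = 0" "br x 0 = 0" for x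
    using lie by (auto simp: lie_bracket_def bilinear_lzero bilinear_rzero)
  have "linear \<phi>"
  proof (rule linearI)
    show "\<phi> (u + v) = \<phi> u + \<phi> v" for u v
      using linear_add[OF \<psi>(1), of "(u, 0)" "(v, 0)"] by (simp add: \<psi>\<phi>)
    show "\<phi> (r *\<^sub>R u) = r *\<^sub>R \<phi> u" for r u
      using linear_cmul[OF \<psi>(1), of r "(u, 0)"] by (simp add: \<psi>\<phi>)
  qed
  moreover have "bij \<phi>"
  proof (rule bijI)
    show "inj \<phi>"
    proof (rule injI)
      fix u v assume "\<phi> u = \<phi> v"
      then have "\<psi> (u, 0) = \<psi> (v, 0)" by (simp add: \<psi>\<phi>)
      then show "u = v" using inv(1) by (metis fst_conv)
    qed
    have "\<phi> (fst (inv_into UNIV \<psi> (X, 0))) = X" for X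
      unfolding \<phi>_def using ideal'[of X] inv(2)[of "(X, 0)"] by (metis fst_conv prod.collapse)
    then show "surj \<phi>" by (rule surjI)
  qed
  moreover have "\<phi> (br u v) = br (\<phi> u) (\<phi> v)" for u v
    using hom[of "(u, 0)" "(v, 0)"] by (simp add: semidirect_bracket_def \<psi>\<phi>)
  ultimately have "lie_automorphism br \<phi>" by (simp add: lie_automorphism_def)
  moreover have "c \<noteq> 0"
  proof
    \<comment> \<open>Then \<open>\<psi>\<close> would send \<open>T\<close> into the ideal, and the
      inverse would return \<open>T\<close> as an element of the ideal.\<close>
    assume "c = 0"
    then have "inv_into UNIV \<psi> (\<psi> (0, 1)) = inv_into UNIV \<psi> (y, 0)" by (simp add: yc)
    then show False using ideal'[of y] by (metis inv(1) snd_conv zero_neq_one)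
  qed
  moreover have "\<phi> (\<alpha> x) = br y (\<phi> x) + c *\<^sub>R \<beta> (\<phi> x)" for x
    using hom[of "(0, 1)" "(x, 0)"]
    by (simp add: semidirect_bracket_def \<psi>\<phi> yc br0 linear_0[OF lin(1)])
  ultimately show thesis using that by blast
qed

section \<open>Conjugating \<open>\<alpha>\<close> to a multiple of \<open>\<beta>\<close> and
  comparing eigenspaces\<close>

lemma lie_automorphism_inv:
  assumes "lie_automorphism br \<Phi>"
  shows "lie_automorphism br (inv_into UNIV \<Phi>)"
proof -
  have *: "linear \<Phi>" "bij \<Phi>" "\<And>x y. \<Phi> (br x y) = br (\<Phi> x) (\<Phi> y)"
    using assms by (auto simp: lie_automorphism_def)
  have inv: "inv_into UNIV \<Phi> (\<Phi> x) = x" "\<Phi> (inv_into UNIV \<Phi> x) = x" for x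
    using *(2) by (auto simp: bij_is_inj bij_is_surj surj_f_inv_f)
  have "linear (inv_into UNIV \<Phi>)"
    by (rule linearI) (metis inv linear_add[OF *(1)], metis inv linear_cmul[OF *(1)])
  moreover have "inv_into UNIV \<Phi> (br x y) = br (inv_into UNIV \<Phi> x) (inv_into UNIV \<Phi> y)" for x y
    by (metis inv *(3))
  ultimately show ?thesis using *(2) by (simp add: lie_automorphism_def bij_imp_bij_inv)
qed

lemma lie_automorphism_compose:
  "lie_automorphism br \<Phi> \<Longrightarrow> lie_automorphism br \<Psi> \<Longrightarrow> lie_automorphism br (\<Phi> \<circ> \<Psi>)"
  by (auto simp: lie_automorphism_def intro: linear_compose bij_comp)

theorem proposition4p7:
  fixes br :: "'a::real_vector \<Rightarrow> 'a \<Rightarrow> 'a"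
    and \<alpha> \<beta> :: "'a \<Rightarrow> 'a"
    and G :: "'g::{t2_space,second_countable_topology} monoid"
    and A :: "('g, 'e::euclidean_space) atlas"
    and H :: "'h::{t2_space,second_countable_topology} monoid"
    and B :: "('h, 'f::euclidean_space) atlas"
  assumes "finite_dimensional TYPE('a)"
    and "lie_bracket br"
    and "nilpotent_bracket br"
    and "derivation br \<alpha>" and "real_diagonalizable \<alpha>"
    and "\<And>\<mu>. eigenvalue_of \<alpha> \<mu> \<Longrightarrow> \<mu> > 0"
    and "derivation br \<beta>" and "real_diagonalizable \<beta>"
    and "\<And>\<mu>. eigenvalue_of \<beta> \<mu> \<Longrightarrow> \<mu> > 0"
    and "heintze_group br \<alpha> G A"
    and "heintze_group br \<beta> H B"
    and "isomorphic_lie_groups G A H B"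
  shows "equivalent_gradings br (eigenspace \<alpha>) (eigenspace \<beta>)"
proof -
  have lin: "linear \<alpha>" "linear \<beta>" using assms(4,7) by (auto simp: derivation_def)
  have surj: "surj \<alpha>" "surj \<beta>"
    using positive_diagonalizable_surj[OF assms(1) lin(1) assms(5,6)]
      positive_diagonalizable_surj[OF assms(1) lin(2) assms(8,9)] by auto
  obtain \<psi> where \<psi>: "linear \<psi>" "bij \<psi>"
    "\<And>x y. \<psi> (semidirect_bracket br \<alpha> x y) = semidirect_bracket br \<beta> (\<psi> x) (\<psi> y)"
    using isomorphic_lie_groups_lie_algebra_iso assms(10-12) unfolding heintze_group_def by metis
  obtain \<phi> y c where \<phi>: "lie_automorphism br \<phi>" "c \<noteq> 0"
    "\<And>x. \<phi> (\<alpha> x) = br y (\<phi> x) + c *\<^sub>R \<beta> (\<phi> x)"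
    using semidirect_iso_restrict[OF assms(2) surj lin \<psi>] by metis
  obtain S wt where S: "weight_basis S" "\<And>b. b \<in> S \<Longrightarrow> \<beta> b = wt b *\<^sub>R b" "\<And>b. b \<in> S \<Longrightarrow> 0 < wt b"
    using diagonalizable_positive_basis[OF assms(1,8,9)] by metis
  interpret graded_lie_algebra S wt br \<beta>
    using S assms(2,7) by (simp add: graded_lie_algebra_def graded_lie_algebra_axioms_def)
  obtain \<Phi> where \<Phi>: "lie_automorphism br \<Phi>"
    "\<And>x. br y (\<Phi> x) + c *\<^sub>R \<beta> (\<Phi> x) = \<Phi> (c *\<^sub>R \<beta> x)"
    using perturbed_derivation_conjugate[OF \<phi>(2)] by metis
  \<comment> \<open>\<open>\<phi>\<close> carries \<open>\<alpha>\<close>, and \<open>\<Phi>\<close>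
    carries \<open>c \<beta>\<close>, to the same derivation \<open>ad y + c \<beta>\<close>; so
    \<open>\<Psi>\<close> carries \<open>\<alpha>\<close> to \<open>c \<beta>\<close>.\<close>
  define \<Psi> where "\<Psi> = inv_into UNIV \<Phi> \<circ> \<phi>"
  have aut: "lie_automorphism br \<Psi>"
    unfolding \<Psi>_def by (intro lie_automorphism_compose lie_automorphism_inv \<Phi> \<phi>)
  then have lin\<Psi>: "linear \<Psi>" and bij\<Psi>: "bij \<Psi>" by (auto simp: lie_automorphism_def)
  have "bij \<Phi>" using \<Phi> by (simp add: lie_automorphism_def)
  then have \<Phi>\<Psi>: "\<Phi> (\<Psi> x) = \<phi> x" for x by (simp add: \<Psi>_def bij_is_surj surj_f_inv_f)
  have "\<Phi> (\<Psi> (\<alpha> x)) = \<Phi> (c *\<^sub>R \<beta> (\<Psi> x))" for x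
    by (simp only: \<Phi>\<Psi> \<phi>(3) \<Phi>(2)[symmetric])
  then have conj: "\<Psi> (\<alpha> x) = c *\<^sub>R \<beta> (\<Psi> x)" for x
    using \<open>bij \<Phi>\<close> by (metis bij_pointE)
  \<comment> \<open>An eigenvalue \<open>\<mu>\<close> of \<open>\<alpha>\<close> is one of
    \<open>c \<beta>\<close>, hence the weight for \<open>\<beta>\<close> is
    \<open>\<mu> / c\<close>.\<close>
  have mem: "\<Psi> x \<in> eigenspace \<beta> (\<mu> / c) \<longleftrightarrow> x \<in> eigenspace \<alpha> \<mu>" for x \<mu>
  proof -
    have "\<alpha> x = \<mu> *\<^sub>R x \<longleftrightarrow> \<Psi> (\<alpha> x) = \<Psi> (\<mu> *\<^sub>R x)"
      using bij\<Psi> by (metis bij_pointE)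
    also have "\<dots> \<longleftrightarrow> c *\<^sub>R \<beta> (\<Psi> x) = c *\<^sub>R ((\<mu> / c) *\<^sub>R \<Psi> x)"
      using \<phi>(2) by (simp add: conj linear_cmul[OF lin\<Psi>])
    also have "\<dots> \<longleftrightarrow> \<beta> (\<Psi> x) = (\<mu> / c) *\<^sub>R \<Psi> x"
      using \<phi>(2) by (metis scaleR_cancel_left)
    finally show ?thesis by (simp add: eigenspace_def)
  qed
  have "eigenspace \<beta> (\<mu> / c) = \<Psi> ` eigenspace \<alpha> \<mu>" for \<mu>
  proof
    show "eigenspace \<beta> (\<mu> / c) \<subseteq> \<Psi> ` eigenspace \<alpha> \<mu>"
      using mem bij\<Psi> by (metis bij_pointE image_eqI subsetI)
  qed (use mem in auto)
  moreover have "bij (\<lambda>\<mu>. \<mu> / c)"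
    by (rule bij_betw_byWitness[of _ "\<lambda>\<mu>. \<mu> * c"]) (use \<phi>(2) in auto)
  ultimately show ?thesis
    using aut unfolding equivalent_gradings_def
    by (intro exI[of _ \<Psi>] exI[of _ "\<lambda>\<mu>. \<mu> / c"]) (simp add: add_divide_distrib)
qed

end
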